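(* Let $P$ and $Q$ be probability distributions of real random variables with probability densities $h$ and $g$, respectively, with respect to Lebesgue measure on $\mathbb{R}$. For any $p\ge 1$ let $$d^p(h,g)=\Big(\big(\int (h-g)^+\,dx\big)^p+\big(\int (h-g)^-\,dx\big)^p\Big)^{1/p}.$$ Then $$d^p(h,g)\le\sqrt{2\min\big(D_{\mathrm{KL}}(P\|Q),\,D_{\mathrm{KL}}(Q\|P)\big)}.$$
   Context: For a real function $f$, $f^+=\max(f,0)$ and $f^-=\max(-f,0)$. $D_{\mathrm{KL}}(P\|Q)\in[0,\infty]$ is the Kullback–Leibler divergence (natural logarithm), i.e. the expectation under $Q$ of $\varphi(dP/dQ)$ with $\varphi(t)=t\log t$, equal to $+\infty$ if $P$ is not absolutely continuous with respect to $Q$. *)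

theory Defs
  imports "HOL-Probability.Probability"
begin

text \<open>Quasi-integral with values in the extended reals; it is meaningful whenever the positive or
  the negative part of \<open>f\<close> has finite integral. (\<open>ennreal\<close> maps negative reals to 0, so the two
  terms are the integrals of the positive and of the negative part.)\<close>

definition ext_integral :: "'a measure \<Rightarrow> ('a \<Rightarrow> real) \<Rightarrow> ereal" where
  "ext_integral M f =
     enn2ereal (\<integral>\<^sup>+x. ennreal (f x) \<partial>M) - enn2ereal (\<integral>\<^sup>+x. ennreal (- f x) \<partial>M)"

text \<open>Kullback--Leibler divergence of \<open>P\<close> from \<open>Q\<close>, for probability measures on the same
  measurable space. The library's \<open>KL_divergence\<close> is real-valued and hence cannot take the value
  \<open>\<infinity>\<close>. The integrand is \<open>\<phi>(dP/dQ)\<close> with \<open>\<phi>(t) = t ln t\<close>, \<open>\<phi>(0) = 0\<close>; since \<open>\<phi> \<ge> -1/e\<close>, the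
  negative part is integrable. Note that \<open>RN_deriv Q P\<close> is \<open>dP/dQ\<close> and \<open>absolutely_continuous Q P\<close>
  is \<open>P \<lless> Q\<close>.\<close>

definition KL_div :: "'a measure \<Rightarrow> 'a measure \<Rightarrow> ereal" where
  "KL_div P Q =
     (if absolutely_continuous Q P
      then ext_integral Q (\<lambda>x. let t = enn2real (RN_deriv Q P x) in t * ln t)
      else \<infinity>)"

definition ereal_sqrt :: "ereal \<Rightarrow> ereal" where
  "ereal_sqrt x = (case x of ereal r \<Rightarrow> ereal (sqrt r) | PInfty \<Rightarrow> \<infinity> | MInfty \<Rightarrow> -\<infinity>)"

definition density_dist :: "real \<Rightarrow> (real \<Rightarrow> real) \<Rightarrow> (real \<Rightarrow> real) \<Rightarrow> real" where
  "density_dist p h g =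
     ((\<integral>x. max (h x - g x) 0 \<partial>lborel) powr p
      + (\<integral>x. max (- (h x - g x)) 0 \<partial>lborel) powr p) powr (1 / p)"

text \<open>\<open>f\<close> is a probability density of \<open>P\<close> with respect to Lebesgue measure on the line.\<close>

definition lebesgue_pdf :: "real measure \<Rightarrow> (real \<Rightarrow> real) \<Rightarrow> bool" where
  "lebesgue_pdf P f \<longleftrightarrow>
     f \<in> borel_measurable borel \<and> (\<forall>x. 0 \<le> f x) \<and> P = density lborel (\<lambda>x. ennreal (f x))"

end

theory Submission
  imports Defs
begin

text \<open>
  Both integrals in \<open>d\<^sup>p(h,g)\<close> equal \<open>a = P(A) - Q(A)\<close> for \<open>A = {g < h}\<close>, because \<open>h\<close> and \<open>g\<close> have
  the same total mass; hence \<open>d\<^sup>p(h,g) = 2 powr (1/p) * a \<le> 2 * a\<close>, and what remains is Pinsker's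
  inequality for the event \<open>A\<close>. With \<open>t = dP/dQ\<close>, it follows by integrating
  \<open>\<bar>t - 1\<bar> \<le> (l * (2 * t + 4) / 3 + (t * ln t - t + 1) / l) / 2\<close> against \<open>Q\<close>, which gives
  \<open>2 * a \<le> l + KL / (2 * l)\<close> for all \<open>l > 0\<close>, and optimising in \<open>l\<close>. The pointwise bound is AM-GM
  applied to \<open>3 * (t - 1)\<^sup>2 \<le> (2 * t + 4) * (t * ln t - t + 1)\<close>. Working with a free parameter \<open>l\<close>
  replaces the usual appeal to the Cauchy-Schwarz inequality.
\<close>

section \<open>Scalar inequalities for \<open>t * ln t\<close>\<close>

text \<open>This is \<open>pinsker_pointwise\<close> solved for \<open>ln t\<close>, because
  \<open>3 * (t - 1)\<^sup>2 + (2 * t + 4) * (t - 1) = (t - 1) * (5 * t + 1)\<close>. With the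
  logarithm isolated, the difference of the two sides has a rational derivative with the sign of
  \<open>t - 1\<close>, so it is minimal at 1, where it vanishes.\<close>

lemma ln_ge_rational:
  fixes t :: real
  assumes "0 < t"
  shows "(t - 1) * (5 * t + 1) / (t * (2 * t + 4)) \<le> ln t"
proof -
  define f where "f = (\<lambda>t::real. ln t - (t - 1) * (5 * t + 1) / (t * (2 * t + 4)))"
  have deriv: "(f has_real_derivative (x - 1) ^ 3 / (x * (x + 2))\<^sup>2) (at x)" if "0 < x" for x
  proof -
    have ne: "x * (2 * x + 4) \<noteq> 0" "x \<noteq> 0" "x + 2 \<noteq> 0" "2 * x + 4 \<noteq> 0" using that by auto
    have "(f has_real_derivative 1 / x - (((5 * x + 1) + (x - 1) * 5) * (x * (2 * x + 4))
        - (x - 1) * (5 * x + 1) * ((2 * x + 4) + x * 2)) / ((x * (2 * x + 4)) * (x * (2 * x + 4))))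
        (at x)"
      unfolding f_def using ne that
      by (auto intro!: derivative_eq_intros)
    also have "1 / x - (((5 * x + 1) + (x - 1) * 5) * (x * (2 * x + 4))
        - (x - 1) * (5 * x + 1) * ((2 * x + 4) + x * 2)) / ((x * (2 * x + 4)) * (x * (2 * x + 4)))
        = (x - 1) ^ 3 / (x * (x + 2))\<^sup>2"
    proof -
      have eq: "2 * x + 4 = 2 * (x + 2)" by simp
      show ?thesis
        unfolding eq using ne(2,3)
        by (simp add: divide_simps) (simp add: algebra_simps power2_eq_square power3_eq_cube)
    qed
    finally show ?thesis .
  qed
  have "f 1 \<le> f t"
  proof (cases "1 \<le> t")
    case True
    show ?thesis
    proof (rule DERIV_nonneg_imp_nondecreasing[OF True])
      fix x :: real assume "1 \<le> x" "x \<le> t"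
      then show "\<exists>y. (f has_real_derivative y) (at x) \<and> 0 \<le> y"
        using deriv[of x] by (intro exI[of _ "(x - 1) ^ 3 / (x * (x + 2))\<^sup>2"]) auto
    qed
  next
    case False
    then have "t \<le> 1" by simp
    then show ?thesis
    proof (rule DERIV_nonpos_imp_nonincreasing)
      fix x :: real assume x: "t \<le> x" "x \<le> 1"
      have "(x - 1) ^ 3 \<le> 0"
        using x by (simp add: power3_eq_cube mult_nonneg_nonpos)
      then show "\<exists>y. (f has_real_derivative y) (at x) \<and> y \<le> 0"
        using deriv[of x] x assms
        by (intro exI[of _ "(x - 1) ^ 3 / (x * (x + 2))\<^sup>2"]) (auto simp: divide_nonpos_nonneg)
    qed
  qed
  then show ?thesis by (simp add: f_def)
qed

text \<open>The affine weight \<open>2 * t + 4\<close> makes both sides agree to third order at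
  \<open>t = 1\<close>, and its mean under \<open>Q\<close> is determined by the mean of
  \<open>t\<close>.\<close>

lemma pinsker_pointwise:
  fixes t :: real
  assumes "0 \<le> t"
  shows "3 * (t - 1)\<^sup>2 \<le> (2 * t + 4) * (t * ln t - t + 1)"
proof (cases "t = 0")
  case False
  then have t: "0 < t" using assms by simp
  then have "(t - 1) * (5 * t + 1) \<le> ln t * (t * (2 * t + 4))"
    using ln_ge_rational[OF t] by (simp add: pos_divide_le_eq)
  then show ?thesis by (simp add: algebra_simps power2_eq_square)
\<comment> \<open>At \<open>t = 0\<close> the claim reads \<open>3 \<le> 4\<close>.\<close>
qed simp

text \<open>Used three times: for the sign of \<open>v\<close> in the AM-GM step, to bound the
  negative part of \<open>t * ln t\<close> by 1, and, integrated, for the nonnegativity of the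
  divergence.\<close>

lemma xlnx_ge:
  fixes t :: real
  assumes "0 \<le> t"
  shows "t - 1 \<le> t * ln t"
proof -
  have "0 \<le> (2 * t + 4) * (t * ln t - t + 1)"
    using pinsker_pointwise[OF assms] by (smt (verit) zero_le_power2)
  then show ?thesis using assms by (simp add: zero_le_mult_iff)
qed

lemma pinsker_pointwise_linear:
  fixes t l :: real
  assumes "0 \<le> t" "0 < l"
  shows "\<bar>t - 1\<bar> \<le> (l * ((2 * t + 4) / 3) + (t * ln t - t + 1) / l) / 2"
proof -
  define u where "u = (2 * t + 4) / 3"
  define v where "v = t * ln t - t + 1"
  have "0 \<le> u" "0 \<le> v" "(t - 1)\<^sup>2 \<le> u * v"
    using pinsker_pointwise[OF assms(1)] xlnx_ge[OF assms(1)] assms by (auto simp: u_def v_def)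
  \<comment> \<open>The parameter cancels in \<open>(l * u) * (v / l)\<close>, so AM-GM yields one
    bound for each \<open>l\<close>.\<close>
  then have "\<bar>t - 1\<bar> \<le> sqrt ((l * u) * (v / l))"
    using assms by (intro real_le_rsqrt) auto
  also have "\<dots> \<le> (l * u + v / l) / 2"
    using \<open>0 \<le> u\<close> \<open>0 \<le> v\<close> assms by (intro arith_geo_mean_sqrt) auto
  finally show ?thesis by (simp add: u_def v_def)
qed

section \<open>The divergence as a real integral, and the optimisation in \<open>l\<close>\<close>

text \<open>With a finite negative part no \<open>\<infinity> - \<infinity>\<close> arises, and
  integrability can fail only through an infinite positive part.\<close>

lemma ext_integral_finite:
  assumes "f \<in> borel_measurable M" "integrable M (\<lambda>x. max (- f x) 0)"
  shows "ext_integral M f = (if integrable M f then ereal (integral\<^sup>L M f) else \<infinity>)"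
proof -
  have "(\<integral>\<^sup>+x. ennreal (- f x) \<partial>M) = (\<integral>\<^sup>+x. ennreal (max (- f x) 0) \<partial>M)"
    by (intro nn_integral_cong) (auto simp: max_def ennreal_neg)
  also have "\<dots> = ennreal (\<integral>x. max (- f x) 0 \<partial>M)"
    by (rule nn_integral_eq_integral[OF assms(2)]) simp
  also have "\<dots> < \<infinity>" by simp
  finally have neg: "(\<integral>\<^sup>+x. ennreal (- f x) \<partial>M) < \<infinity>" .
  show ?thesis
  proof (cases "integrable M f")
    case True
    then have pos: "(\<integral>\<^sup>+x. ennreal (f x) \<partial>M) \<noteq> \<infinity>"
      unfolding real_integrable_def by simp
    have "ereal (integral\<^sup>L M f) = ext_integral M f"
      unfolding ext_integral_def real_lebesgue_integral_def[OF True]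
      using pos neg by (cases "\<integral>\<^sup>+x. ennreal (f x) \<partial>M"; cases "\<integral>\<^sup>+x. ennreal (- f x) \<partial>M") auto
    then show ?thesis using True by simp
  next
    case False
    then have "(\<integral>\<^sup>+x. ennreal (f x) \<partial>M) = \<infinity>"
      using assms(1) neg unfolding real_integrable_def by auto
    then show ?thesis
      using False neg unfolding ext_integral_def
      by (cases "\<integral>\<^sup>+x. ennreal (- f x) \<partial>M") auto
  qed
qed

lemma le_sqrt_if_le_param:
  fixes a k :: real
  assumes "0 \<le> k" "\<And>l. 0 < l \<Longrightarrow> a \<le> l + k / (2 * l)"
  shows "a \<le> sqrt (2 * k)"
proof (cases "k = 0")
  case True
  \<comment> \<open>Here the infimum is not attained; \<open>l\<close> tends to 0 instead.\<close>
  then show ?thesis using assms(2) by (auto intro: field_le_epsilon)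
next
  case False
  \<comment> \<open>The minimiser of \<open>l + k / (2 * l)\<close>; both summands then equal
    \<open>l\<close>.\<close>
  define l where "l = sqrt (2 * k) / 2"
  have "0 < l" "sqrt (2 * k) = 2 * l" using False assms(1) by (auto simp: l_def)
  moreover have "2 * k = (2 * l) * (2 * l)"
    using \<open>sqrt (2 * k) = 2 * l\<close> assms(1) real_sqrt_mult_self[of "2 * k"] by simp
  ultimately show ?thesis using assms(2)[of l] by (simp add: field_simps)
qed

section \<open>Pinsker's inequality for a single event\<close>

text \<open>The absolute value makes the left side symmetric in \<open>P\<close> and
  \<open>Q\<close>, so the same event serves both orders of the divergence. If the divergence is
  infinite, the bound is trivial.\<close>

theorem pinsker_event:
  assumes "prob_space P" "prob_space Q" "sets P = sets Q" "A \<in> sets Q"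
  shows "ereal (2 * \<bar>measure P A - measure Q A\<bar>) \<le> ereal_sqrt (2 * KL_div P Q)"
proof (cases "absolutely_continuous Q P")
  case False
  then show ?thesis by (simp add: KL_div_def ereal_sqrt_def)
next
  case True
  interpret P: prob_space P by fact
  interpret Q: prob_space Q by fact
  define t where "t = (\<lambda>x. enn2real (RN_deriv Q P x))"
  have [measurable]: "t \<in> borel_measurable Q" by (simp add: t_def)
  have t_nonneg: "0 \<le> t x" for x by (simp add: t_def)
  \<comment> \<open>Almost everywhere finiteness lets the real-valued \<open>t\<close> replace the
    derivative without changing the measure.\<close>
  have "AE x in Q. RN_deriv Q P x \<noteq> \<infinity>"
    using P.sigma_finite_measure_axioms True assms(3)
    by (intro Q.RN_deriv_finite) auto
  then have "density Q (RN_deriv Q P) = density Q (\<lambda>x. ennreal (t x))"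
    by (intro density_cong) (auto simp: t_def less_top)
  then have P_eq: "P = density Q (\<lambda>x. ennreal (t x))"
    using Q.density_RN_deriv[OF True assms(3)] by simp
  have prob_eq: "measure P B = (\<integral>x. t x * indicator B x \<partial>Q)" "integrable Q (\<lambda>x. t x * indicator B x)"
    if B: "B \<in> sets Q" for B
  proof -
    have *: "emeasure P B = (\<integral>\<^sup>+x. ennreal (t x * indicator B x) \<partial>Q)"
      using B by (subst P_eq) (auto simp: emeasure_density ennreal_mult' indicator_def intro!: nn_integral_cong)
    then show int: "integrable Q (\<lambda>x. t x * indicator B x)"
      using B t_nonneg P.emeasure_finite[of B]
      by (intro integrableI_nonneg) (auto simp: less_top)
    show "measure P B = (\<integral>x. t x * indicator B x \<partial>Q)"
      unfolding measure_def * using int t_nonneg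
      by (subst nn_integral_eq_integral) (auto intro!: integral_nonneg_AE)
  qed
  have space_eq: "space P = space Q" using assms(3) by (rule sets_eq_imp_space_eq)
  have ind: "(\<lambda>x. t x * indicator (space Q) x) x = t x" if "x \<in> space Q" for x using that by simp
  have t_int: "integrable Q t" 
    using prob_eq(2)[OF sets.top] ind by (simp cong: Bochner_Integration.integrable_cong)
  have t_one: "(\<integral>x. t x \<partial>Q) = 1"
    using prob_eq(1)[OF sets.top] ind P.prob_space
    by (simp add: space_eq cong: Bochner_Integration.integral_cong)
  define f where "f = (\<lambda>x. t x * ln (t x))"
  have f_meas [measurable]: "f \<in> borel_measurable Q" by (simp add: f_def)
  have f_ge: "t x - 1 \<le> f x" for x using xlnx_ge[OF t_nonneg] by (simp add: f_def)
  have "- f x \<le> 1" for x using f_ge[of x] t_nonneg[of x] by linarith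
  then have "integrable Q (\<lambda>x. max (- f x) 0)"
    by (intro Q.integrable_const_bound[where B = 1]) auto
  then have KL: "KL_div P Q = (if integrable Q f then ereal (integral\<^sup>L Q f) else \<infinity>)"
    using ext_integral_finite[OF f_meas] True by (simp add: KL_div_def f_def t_def Let_def)
  show ?thesis
  proof (cases "integrable Q f")
    case False
    then show ?thesis by (simp add: KL ereal_sqrt_def)
  next
    case f_int: True
    define K where "K = integral\<^sup>L Q f"
    have "(\<integral>x. t x - 1 \<partial>Q) \<le> K"
      unfolding K_def using t_int f_int f_ge by (intro integral_mono) auto
    then have K_nonneg: "0 \<le> K" using t_int t_one by (simp add: Q.prob_space)
    have tm: "integrable Q (\<lambda>x. t x - 1)" using t_int by simp
    have tm0: "(\<integral>x. t x - 1 \<partial>Q) = 0" using t_int t_one by (simp add: Q.prob_space)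
    have i1: "integrable Q (\<lambda>x. indicator A x * (t x - 1))"
      by (rule Bochner_Integration.integrable_bound[OF tm])
         (use assms(4) in \<open>auto simp: indicator_def\<close>)
    have diff: "measure P A - measure Q A = (\<integral>x. indicator A x * (t x - 1) \<partial>Q)"
    proof -
      have "(\<integral>x. indicator A x * (t x - 1) \<partial>Q) = (\<integral>x. t x * indicator A x - indicator A x \<partial>Q)"
        by (intro Bochner_Integration.integral_cong) (auto simp: algebra_simps)
      also have "\<dots> = measure P A - measure Q A"
        using prob_eq[OF assms(4)] assms(4)
        by (subst Bochner_Integration.integral_diff) (auto simp: less_top[symmetric])
      finally show ?thesis by simp
    qed
    have "2 * \<bar>measure P A - measure Q A\<bar> \<le> l + K / (2 * l)" if l: "0 < l" for l
    proof -
      \<comment> \<open>Since \<open>t - 1\<close> has mean 0, subtracting it is free and turns the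
        factor \<open>2 * indicator A x\<close> into a sign, so the integrand has absolute value
        \<open>\<bar>t x - 1\<bar>\<close>.\<close>
      have "2 * (measure P A - measure Q A) = (\<integral>x. 2 * (indicator A x * (t x - 1)) - (t x - 1) \<partial>Q)"
        using i1 tm tm0 diff by (subst Bochner_Integration.integral_diff) auto
      then have "2 * \<bar>measure P A - measure Q A\<bar>
          = \<bar>\<integral>x. 2 * (indicator A x * (t x - 1)) - (t x - 1) \<partial>Q\<bar>"
        by (metis abs_mult abs_numeral)
      also have "\<dots> \<le> (\<integral>x. \<bar>2 * (indicator A x * (t x - 1)) - (t x - 1)\<bar> \<partial>Q)"
        by (rule integral_abs_bound)
      also have "\<dots> = (\<integral>x. \<bar>t x - 1\<bar> \<partial>Q)"
        by (intro Bochner_Integration.integral_cong) (auto simp: indicator_def)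
      also have "\<dots> \<le> (\<integral>x. (l * ((2 * t x + 4) / 3) + (f x - t x + 1) / l) / 2 \<partial>Q)"
        using t_int f_int pinsker_pointwise_linear[OF t_nonneg l]
        by (intro integral_mono) (auto simp: f_def)
      \<comment> \<open>Only the means of \<open>t\<close> and \<open>f\<close> enter, namely 1 and
        \<open>K\<close>; the weight has mean 2.\<close>
      also have "\<dots> = (l * ((2 * 1 + 4) / 3) + (K - 1 + 1) / l) / 2"
        using t_int f_int by (simp add: t_one K_def Q.prob_space add_divide_distrib diff_divide_distrib)
      also have "\<dots> = l + K / (2 * l)" by (simp add: field_simps)
      finally show ?thesis .
    qed
    then have "2 * \<bar>measure P A - measure Q A\<bar> \<le> sqrt (2 * K)"
      by (rule le_sqrt_if_le_param[OF K_nonneg])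
    moreover have "2 * KL_div P Q = ereal (2 * K)"
      using f_int by (simp add: KL K_def flip: times_ereal.simps(1))
    ultimately show ?thesis
      by (simp add: ereal_sqrt_def)
  qed
qed

section \<open>Lebesgue densities and the two parts of their difference\<close>

lemma lebesgue_pdf_measure:
  assumes "real_distribution P" "lebesgue_pdf P h" "B \<in> sets borel"
  shows "integrable lborel (\<lambda>x. h x * indicator B x)"
    and "measure P B = (\<integral>x. h x * indicator B x \<partial>lborel)"
proof -
  interpret P: real_distribution P by fact
  have h [measurable]: "h \<in> borel_measurable borel" and nonneg: "\<And>x. 0 \<le> h x"
    and P_eq: "P = density lborel (\<lambda>x. ennreal (h x))"
    using assms(2) by (auto simp: lebesgue_pdf_def)
  have *: "emeasure P B = (\<integral>\<^sup>+x. ennreal (h x * indicator B x) \<partial>lborel)"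
    using assms(3) by (subst P_eq)
      (auto simp: emeasure_density ennreal_mult' indicator_def intro!: nn_integral_cong)
  then show int: "integrable lborel (\<lambda>x. h x * indicator B x)"
    using assms(3) nonneg P.emeasure_finite[of B]
    by (intro integrableI_nonneg) (auto simp: less_top)
  show "measure P B = (\<integral>x. h x * indicator B x \<partial>lborel)"
    unfolding measure_def * using int nonneg
    by (subst nn_integral_eq_integral) (auto intro!: integral_nonneg_AE)
qed

lemma integral_pos_part_diff:
  assumes "real_distribution P" "real_distribution Q" "lebesgue_pdf P h" "lebesgue_pdf Q g"
  defines "A \<equiv> {x. g x < h x}"
  shows "(\<integral>x. max (h x - g x) 0 \<partial>lborel) = measure P A - measure Q A"
proof -
  have [measurable]: "h \<in> borel_measurable borel" "g \<in> borel_measurable borel"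
    using assms by (auto simp: lebesgue_pdf_def)
  have A: "A \<in> sets borel" unfolding A_def by measurable
  have "(\<integral>x. max (h x - g x) 0 \<partial>lborel) = (\<integral>x. h x * indicator A x - g x * indicator A x \<partial>lborel)"
    by (intro Bochner_Integration.integral_cong) (auto simp: A_def indicator_def)
  also have "\<dots> = measure P A - measure Q A"
    using lebesgue_pdf_measure[OF assms(1,3) A] lebesgue_pdf_measure[OF assms(2,4) A]
    by simp
  finally show ?thesis .
qed

lemma integral_neg_part_diff:
  assumes "real_distribution P" "real_distribution Q" "lebesgue_pdf P h" "lebesgue_pdf Q g"
  shows "(\<integral>x. max (- (h x - g x)) 0 \<partial>lborel) = (\<integral>x. max (h x - g x) 0 \<partial>lborel)"
proof -
  interpret P: real_distribution P by fact
  interpret Q: real_distribution Q by fact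
  have hi: "integrable lborel h" "(\<integral>x. h x \<partial>lborel) = 1"
    using lebesgue_pdf_measure[OF assms(1,3), of UNIV] P.prob_space by auto
  have gi: "integrable lborel g" "(\<integral>x. g x \<partial>lborel) = 1"
    using lebesgue_pdf_measure[OF assms(2,4), of UNIV] Q.prob_space by auto
  have "(\<integral>x. max (- (h x - g x)) 0 \<partial>lborel) = (\<integral>x. max (h x - g x) 0 - (h x - g x) \<partial>lborel)"
    by (intro Bochner_Integration.integral_cong) auto
  also have "\<dots> = (\<integral>x. max (h x - g x) 0 \<partial>lborel)"
    using hi gi by (subst Bochner_Integration.integral_diff) auto
  finally show ?thesis .
qed

theorem proposition4p2:
  fixes P Q :: "real measure" and h g :: "real \<Rightarrow> real" and p :: real
  assumes "real_distribution P" and "real_distribution Q"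
    and "lebesgue_pdf P h" and "lebesgue_pdf Q g"
    and "p \<ge> 1"
  shows "ereal (density_dist p h g) \<le> ereal_sqrt (2 * min (KL_div P Q) (KL_div Q P))"
proof -
  interpret P: real_distribution P by fact
  interpret Q: real_distribution Q by fact
  define A where "A = {x. g x < h x}"
  define a where "a = (\<integral>x. max (h x - g x) 0 \<partial>lborel)"
  have [measurable]: "h \<in> borel_measurable borel" "g \<in> borel_measurable borel"
    using assms by (auto simp: lebesgue_pdf_def)
  have A: "A \<in> sets borel" unfolding A_def by measurable
  have a_eq: "a = measure P A - measure Q A"
    unfolding a_def A_def by (rule integral_pos_part_diff[OF assms(1-4)])
  have a_nonneg: "0 \<le> a" by (simp add: a_def)
  have "density_dist p h g = (2 * a powr p) powr (1 / p)"
    unfolding density_dist_def integral_neg_part_diff[OF assms(1-4)] by (simp add: a_def)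
  \<comment> \<open>The case \<open>a = 0\<close> is included, since
    \<open>0 powr p = 0\<close>.\<close>
  also have "\<dots> = 2 powr (1 / p) * a"
    using a_nonneg assms(5) by (simp add: powr_mult powr_powr)
  \<comment> \<open>As \<open>1 / p \<le> 1\<close>, the worst case is \<open>p = 1\<close>, the L1
    distance of the densities.\<close>
  also have "\<dots> \<le> 2 powr 1 * a"
    using a_nonneg assms(5) by (intro mult_right_mono powr_mono) auto
  also have "\<dots> = 2 * a" by simp
  finally have "density_dist p h g \<le> 2 * a" .
  then have *: "ereal (density_dist p h g) \<le> ereal (2 * a)" by simp
  have "ereal (2 * a) \<le> ereal_sqrt (2 * KL_div P Q)"
    using pinsker_event[of P Q A] P.prob_space_axioms Q.prob_space_axioms A a_eq a_nonneg by simp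
  moreover have "ereal (2 * a) \<le> ereal_sqrt (2 * KL_div Q P)"
    using pinsker_event[of Q P A] P.prob_space_axioms Q.prob_space_axioms A a_eq a_nonneg
    by (simp add: abs_minus_commute)
  ultimately show ?thesis
    using order_trans[OF *] unfolding min_def by presburger
qed

end
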